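(* Let $(Y,d)$ be a compact metric space and let $g:Y\to Y$ be continuous and surjective. Suppose that $(Y,d,g)$ satisfies Axioms 1 and 2 with constants $\beta>0$, $K\geq 1$, $0<\gamma<1$. Let $\hat Y$ be the stationary inverse limit of $(Y,g)$, with induced map $\hat g$ and metric $\hat d$ (defined from $d$, $K$, $\gamma$ as in the context). Then $(\hat Y,\hat d,\hat g)$ is a Smale space with totally disconnected local stable sets. Moreover, $(\hat Y,\hat d,\hat g)$ is an irreducible Smale space if and only if $(Y,d,g)$ is non-wandering and has a dense forward orbit.
   Context: Smale space: Let $(X,d)$ be a compact metric space and $f:X\to X$ a homeomorphism. For $x\in X$, $\epsilon>0$ put $X^s(x,\epsilon)=\{y\in X : d(f^n(x),f^n(y))\leq\epsilon \ \forall n\geq 0\}$ and $X^u(x,\epsilon)=\{y\in X : d(f^{-n}(x),f^{-n}(y))\leq\epsilon\ \forall n\geq 0\}$ (local stable and unstable sets). $(X,d,f)$ is a Smale space if there are constants $\epsilon_X>0$, $\epsilon_X'>0$, $0<\lambda<1$ such that (1) for all $x\in X$, $n\geq 0$: $d(f^n(y),f^n(z))\leq\lambda^n d(y,z)$ if $y,z\in X^s(x,\epsilon_X')$; (2) for all $x\in X$, $n\ge 0$: $d(f^{-n}(y),f^{-n}(z))\leq\lambda^n d(y,z)$ if $y,z\in X^u(x,\epsilon_X')$; (3) if $d(x,y)\leq\epsilon_X$ then $X^s(x,\epsilon_X')\cap X^u(y,\epsilon_X')$ consists of a single point, denoted $[x,y]$. It has totally disconnected local stable sets if (for such constants) $X^s(x,\epsilon)$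 is totally disconnected for every $x\in X$ and $0<\epsilon\leq\epsilon_X$. It is irreducible if it is non-wandering and has a dense orbit $\{f^n(x): n\in\mathbb Z\}$. A system is non-wandering if for every non-empty open set $U$ there is $n\geq 1$ such that the $n$-th image of $U$ meets $U$. A dense forward orbit of $g$ is a dense set of the form $\{g^n(x): n\geq 0\}$. Axioms 1 and 2: $B(x,r)$ denotes the closed ball. $(Y,d,g)$ satisfies Axioms 1 and 2 if there exist $\beta>0$, an integer $K\geq 1$ and $0<\gamma<1$ such that: Axiom 1: if $d(x,y)\leq\beta$ then $d(g^K(x),g^K(y))\leq\gamma^K d(g^{2K}(x),g^{2K}(y))$; Axiom 2: for all $x\in Y$ and $0<\epsilon\leq\beta$, $g^K(B(g^K(x),\epsilon))\subseteq g^{2K}(B(x,\gamma\epsilon))$. Inverse limit: $\hat Y=\{(y_0,y_1,y_2,\dots) : y_n\in Y,\ y_n=g(y_{n+1})\ \forall n\geq 0\}$, $\hat g(y_0,y_1,\dots)=(g(y_0),g(y_1),\dots)=(g(y_0),y_0,y_1,\dots)$ (a homeomorphism), $d'(\mathbf x,\mathbf y)=\sup_{n\geq 0}\gamma^n d(x_n,y_n)$, and $\hat d(\mathbf x,\mathbf y)=\sum_{k=0}^{K-1}\gamma^{-k}d'(\hat g^{-k}(\mathbf x),\hat g^{-k}(\mathbf y))$. *)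

theory Defs
  imports "HOL-Analysis.Analysis"
begin

definition totally_disconnected_in :: "'a topology \<Rightarrow> 'a set \<Rightarrow> bool" where
  "totally_disconnected_in X S \<longleftrightarrow>
     S \<subseteq> topspace X \<and> (\<forall>C. C \<subseteq> S \<and> connectedin X C \<longrightarrow> (\<exists>a. C \<subseteq> {a}))"

definition non_wandering :: "'a topology \<Rightarrow> ('a \<Rightarrow> 'a) \<Rightarrow> bool" where
  "non_wandering X f \<longleftrightarrow>
     (\<forall>U. openin X U \<and> U \<noteq> {} \<longrightarrow> (\<exists>n\<ge>1. (f ^^ n) ` U \<inter> U \<noteq> {}))"

definition has_dense_forward_orbit :: "'a topology \<Rightarrow> ('a \<Rightarrow> 'a) \<Rightarrow> bool" where
  "has_dense_forward_orbit X f \<longleftrightarrow>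
     (\<exists>x\<in>topspace X. X closure_of (range (\<lambda>n. (f ^^ n) x)) = topspace X)"

text \<open>
  Below, the inverse of a bijection \<open>f\<close> of the carrier \<open>M\<close> is \<open>inv_into M f\<close>.
\<close>

definition int_iterate :: "'a set \<Rightarrow> ('a \<Rightarrow> 'a) \<Rightarrow> int \<Rightarrow> 'a \<Rightarrow> 'a" where
  "int_iterate M f n = (if n \<ge> 0 then f ^^ nat n else inv_into M f ^^ nat (- n))"

definition has_dense_orbit :: "'a topology \<Rightarrow> ('a \<Rightarrow> 'a) \<Rightarrow> bool" where
  "has_dense_orbit X f \<longleftrightarrow>
     (\<exists>x\<in>topspace X.
        X closure_of (range (\<lambda>n. int_iterate (topspace X) f n x)) = topspace X)"

definition local_stable ::
    "'a set \<Rightarrow> ('a \<Rightarrow> 'a \<Rightarrow> real) \<Rightarrow> ('a \<Rightarrow> 'a) \<Rightarrow> 'a \<Rightarrow> real \<Rightarrow> 'a set" where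
  "local_stable M d f x \<epsilon> = {y \<in> M. \<forall>n. d ((f ^^ n) x) ((f ^^ n) y) \<le> \<epsilon>}"

definition local_unstable ::
    "'a set \<Rightarrow> ('a \<Rightarrow> 'a \<Rightarrow> real) \<Rightarrow> ('a \<Rightarrow> 'a) \<Rightarrow> 'a \<Rightarrow> real \<Rightarrow> 'a set" where
  "local_unstable M d f x \<epsilon> =
     {y \<in> M. \<forall>n. d ((inv_into M f ^^ n) x) ((inv_into M f ^^ n) y) \<le> \<epsilon>}"

definition smale_constants ::
    "'a set \<Rightarrow> ('a \<Rightarrow> 'a \<Rightarrow> real) \<Rightarrow> ('a \<Rightarrow> 'a) \<Rightarrow> real \<Rightarrow> real \<Rightarrow> real \<Rightarrow> bool" where
  "smale_constants M d f \<epsilon> \<epsilon>' lam \<longleftrightarrow>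
     \<epsilon> > 0 \<and> \<epsilon>' > 0 \<and> 0 < lam \<and> lam < 1 \<and>
     (\<forall>x\<in>M. \<forall>n. \<forall>y\<in>local_stable M d f x \<epsilon>'. \<forall>z\<in>local_stable M d f x \<epsilon>'.
        d ((f ^^ n) y) ((f ^^ n) z) \<le> lam ^ n * d y z) \<and>
     (\<forall>x\<in>M. \<forall>n. \<forall>y\<in>local_unstable M d f x \<epsilon>'. \<forall>z\<in>local_unstable M d f x \<epsilon>'.
        d ((inv_into M f ^^ n) y) ((inv_into M f ^^ n) z) \<le> lam ^ n * d y z) \<and>
     (\<forall>x\<in>M. \<forall>y\<in>M. d x y \<le> \<epsilon> \<longrightarrow>
        (\<exists>z. local_stable M d f x \<epsilon>' \<inter> local_unstable M d f y \<epsilon>' = {z}))"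

definition compact_metric_homeo ::
    "'a set \<Rightarrow> ('a \<Rightarrow> 'a \<Rightarrow> real) \<Rightarrow> ('a \<Rightarrow> 'a) \<Rightarrow> bool" where
  "compact_metric_homeo M d f \<longleftrightarrow>
     Metric_space M d \<and> compact_space (Metric_space.mtopology M d) \<and>
     homeomorphic_map (Metric_space.mtopology M d) (Metric_space.mtopology M d) f"

definition smale_space ::
    "'a set \<Rightarrow> ('a \<Rightarrow> 'a \<Rightarrow> real) \<Rightarrow> ('a \<Rightarrow> 'a) \<Rightarrow> bool" where
  "smale_space M d f \<longleftrightarrow>
     compact_metric_homeo M d f \<and> (\<exists>\<epsilon> \<epsilon>' lam. smale_constants M d f \<epsilon> \<epsilon>' lam)"

text \<open>
  The range of radii on which total disconnectedness is required depends on the chosen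
  constants, so they are quantified jointly with the conditions defining a Smale space.
\<close>

definition smale_space_td_stable ::
    "'a set \<Rightarrow> ('a \<Rightarrow> 'a \<Rightarrow> real) \<Rightarrow> ('a \<Rightarrow> 'a) \<Rightarrow> bool" where
  "smale_space_td_stable M d f \<longleftrightarrow>
     compact_metric_homeo M d f \<and>
     (\<exists>\<epsilon> \<epsilon>' lam. smale_constants M d f \<epsilon> \<epsilon>' lam \<and>
        (\<forall>x\<in>M. \<forall>r. 0 < r \<and> r \<le> \<epsilon> \<longrightarrow>
           totally_disconnected_in (Metric_space.mtopology M d) (local_stable M d f x r)))"

definition irreducible_smale_space ::
    "'a set \<Rightarrow> ('a \<Rightarrow> 'a \<Rightarrow> real) \<Rightarrow> ('a \<Rightarrow> 'a) \<Rightarrow> bool" where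
  "irreducible_smale_space M d f \<longleftrightarrow>
     smale_space M d f \<and>
     non_wandering (Metric_space.mtopology M d) f \<and>
     has_dense_orbit (Metric_space.mtopology M d) f"

definition axiom1 ::
    "'a set \<Rightarrow> ('a \<Rightarrow> 'a \<Rightarrow> real) \<Rightarrow> ('a \<Rightarrow> 'a) \<Rightarrow> real \<Rightarrow> nat \<Rightarrow> real \<Rightarrow> bool" where
  "axiom1 Y d g \<beta> K \<gamma> \<longleftrightarrow>
     (\<forall>x\<in>Y. \<forall>y\<in>Y. d x y \<le> \<beta> \<longrightarrow>
        d ((g ^^ K) x) ((g ^^ K) y) \<le> \<gamma> ^ K * d ((g ^^ (2 * K)) x) ((g ^^ (2 * K)) y))"

definition axiom2 ::
    "'a set \<Rightarrow> ('a \<Rightarrow> 'a \<Rightarrow> real) \<Rightarrow> ('a \<Rightarrow> 'a) \<Rightarrow> real \<Rightarrow> nat \<Rightarrow> real \<Rightarrow> bool" where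
  "axiom2 Y d g \<beta> K \<gamma> \<longleftrightarrow>
     (\<forall>x\<in>Y. \<forall>\<epsilon>. 0 < \<epsilon> \<and> \<epsilon> \<le> \<beta> \<longrightarrow>
        (g ^^ K) ` Metric_space.mcball Y d ((g ^^ K) x) \<epsilon>
          \<subseteq> (g ^^ (2 * K)) ` Metric_space.mcball Y d x (\<gamma> * \<epsilon>))"

definition inv_limit :: "'a set \<Rightarrow> ('a \<Rightarrow> 'a) \<Rightarrow> (nat \<Rightarrow> 'a) set" where
  "inv_limit Y g = {y. \<forall>n. y n \<in> Y \<and> y n = g (y (Suc n))}"

definition shift_map :: "('a \<Rightarrow> 'a) \<Rightarrow> (nat \<Rightarrow> 'a) \<Rightarrow> (nat \<Rightarrow> 'a)" where
  "shift_map g y = (\<lambda>n. g (y n))"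

definition sup_dist ::
    "('a \<Rightarrow> 'a \<Rightarrow> real) \<Rightarrow> real \<Rightarrow> (nat \<Rightarrow> 'a) \<Rightarrow> (nat \<Rightarrow> 'a) \<Rightarrow> real" where
  "sup_dist d \<gamma> x y = (SUP n. \<gamma> ^ n * d (x n) (y n))"

text \<open>
  The locale \<^locale>\<open>Metric_space\<close> demands nonnegativity and symmetry also off the carrier,
  where the supremum may be that of an unbounded set; the value there is set to 0.
\<close>

definition hat_dist ::
    "'a set \<Rightarrow> ('a \<Rightarrow> 'a \<Rightarrow> real) \<Rightarrow> ('a \<Rightarrow> 'a) \<Rightarrow> nat \<Rightarrow> real \<Rightarrow>
     (nat \<Rightarrow> 'a) \<Rightarrow> (nat \<Rightarrow> 'a) \<Rightarrow> real" where
  "hat_dist Y d g K \<gamma> x y =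
     (if x \<in> inv_limit Y g \<and> y \<in> inv_limit Y g
      then \<Sum>k<K. \<gamma> powi (- int k) *
             sup_dist d \<gamma> ((inv_into (inv_limit Y g) (shift_map g) ^^ k) x)
                          ((inv_into (inv_limit Y g) (shift_map g) ^^ k) y)
      else 0)"

end

theory Submission
  imports Defs
begin

text \<open>
  By Axiom 1, a point of the inverse limit whose forward orbit stays close to that of \<open>x\<close> has the
  same \<open>K\<close>-th coordinate as \<open>x\<close>, and the shift contracts the distance of such points by \<open>\<gamma>\<close>;
  if the backward orbits stay close, the coordinate distances decay geometrically. Axiom 2 allows one
  to continue \<open>x K\<close> backwards while staying near the coordinates of \<open>y\<close>, which yields the bracket
  \<open>[x, y]\<close>. On a connected subset of a local stable set every coordinate is locally constant,
  again by Axiom 1, hence constant. For the equivalence, the coordinate projections carry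
  non-wandering and dense forward orbits back and forth; a dense two-sided orbit together with
  non-wandering makes the system transitive, and Baire's theorem then gives a dense forward orbit.
\<close>

section \<open>Non-wandering systems and dense orbits\<close>

lemma continuous_map_funpow:
  assumes "continuous_map X X f"
  shows "continuous_map X X (f ^^ n)"
proof (induction n)
  case 0
  then show ?case by (simp add: id_def)
next
  case (Suc n)
  then show ?case
    using continuous_map_compose[OF _ assms] by (simp add: o_def)
qed

text \<open>The points of \<open>W\<close> that are back in \<open>W\<close> after a fixed time
  \<open>n \<ge> 1\<close> form a nonempty open set. A late return of that set to itself can be
  prolonged by \<open>n\<close> steps, which drives the induction on \<open>N\<close>.\<close>

lemma non_wandering_late_return:
  assumes nw: "non_wandering X f" and cont: "continuous_map X X f"
    and "openin X W" "W \<noteq> {}"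
  shows "\<exists>n\<ge>N. \<exists>w\<in>W. (f ^^ n) w \<in> W"
  using assms(3,4)
proof (induction N arbitrary: W)
  case 0
  then show ?case by (intro exI[of _ 0]) auto
next
  case (Suc N)
  obtain n w where n: "n \<ge> 1" "w \<in> W" "(f ^^ n) w \<in> W"
    using nw Suc.prems unfolding non_wandering_def by blast
  define W' where "W' = W \<inter> {x \<in> topspace X. (f ^^ n) x \<in> W}"
  have "openin X W'"
    unfolding W'_def
    using Suc.prems openin_continuous_map_preimage[OF continuous_map_funpow[OF cont]] by blast
  moreover have "w \<in> W'"
    using n Suc.prems openin_subset unfolding W'_def by blast
  ultimately obtain m v where m: "m \<ge> N" "v \<in> W'" "(f ^^ m) v \<in> W'"
    using Suc.IH by blast
  have "(f ^^ (n + m)) v \<in> W"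
    using m by (simp add: W'_def funpow_add)
  moreover have "n + m \<ge> Suc N" using n m by simp
  ultimately show ?case
    using m(2) unfolding W'_def by blast
qed

text \<open>Induction upward from \<open>m\<close> reduces this to a single step. Bijectivity enters
  there for negative exponents, and \<open>k = -1\<close> is where the definition of
  \<open>int_iterate\<close> switches its branch.\<close>

lemma int_iterate_add:
  assumes bij: "bij_betw f M M" and x: "x \<in> M" and "m \<le> k"
  shows "int_iterate M f k x = (f ^^ nat (k - m)) (int_iterate M f m x)"
proof -
  have inv_mem: "(inv_into M f ^^ p) x \<in> M" for p
    using x bij_betw_inv_into[OF bij] by (induction p) (auto simp: bij_betw_def)
  have step_int: "int_iterate M f (k + 1) x = f (int_iterate M f k x)" for k
  proof (cases "k \<ge> 0")
    case True
    then show ?thesis by (simp add: int_iterate_def nat_add_distrib)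
  next
    case False
    define p where "p = nat (- k - 1)"
    have p: "nat (- k) = Suc p" using False by (simp add: p_def)
    have "int_iterate M f (k + 1) x = (inv_into M f ^^ p) x"
      using False by (cases "k = -1") (auto simp: int_iterate_def p_def)
    moreover have "f (int_iterate M f k x) = (inv_into M f ^^ p) x"
      using False p inv_mem bij_betw_inv_into_right[OF bij] by (simp add: int_iterate_def)
    ultimately show ?thesis by simp
  qed
  show ?thesis
    using \<open>m \<le> k\<close>
  proof (induction k rule: int_ge_induct)
    case (step k)
    have "nat (k + 1 - m) = Suc (nat (k - m))"
      using step.hyps by simp
    then show ?case
      using step.IH step_int[of k] by simp
  qed simp
qed

lemma dense_range_meets_open:
  assumes "X closure_of (range h) = topspace X" "openin X U" "U \<noteq> {}"
  obtains n where "h n \<in> U"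
proof -
  have "range h \<inter> U \<noteq> {}"
    using assms dense_intersects_open[of X "range h"] by metis
  then show ?thesis using that by blast
qed

lemma dense_rangeI:
  assumes "\<And>U. openin X U \<Longrightarrow> U \<noteq> {} \<Longrightarrow> \<exists>n. h n \<in> U"
  shows "X closure_of (range h) = topspace X"
  unfolding dense_intersects_open
proof (intro allI impI)
  fix U assume "openin X U \<and> U \<noteq> {}"
  then obtain n where "h n \<in> U" using assms by blast
  then show "range h \<inter> U \<noteq> {}" by blast
qed

text \<open>If the orbit meets \<open>U\<close> no later than \<open>V\<close>, it runs forward from
  \<open>U\<close> to \<open>V\<close>. In the other order, non-wandering supplies a point of
  \<open>V\<close> that passes through \<open>U\<close> before coming back to
  \<open>V\<close>.\<close>

lemma dense_orbit_transitive:
  assumes nw: "non_wandering X f" and homeo: "homeomorphic_map X X f"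
    and orbit: "has_dense_orbit X f"
    and U: "openin X U" "U \<noteq> {}" and V: "openin X V" "V \<noteq> {}"
  shows "\<exists>n. \<exists>x\<in>U. (f ^^ n) x \<in> V"
proof -
  have cont: "continuous_map X X f"
    and bij: "bij_betw f (topspace X) (topspace X)"
    using homeo unfolding homeomorphic_eq_everything_map bij_betw_def by blast+
  obtain x where x: "x \<in> topspace X"
    and dense: "X closure_of (range (\<lambda>n. int_iterate (topspace X) f n x)) = topspace X"
    using orbit unfolding has_dense_orbit_def by blast
  obtain i where i: "int_iterate (topspace X) f i x \<in> U"
    using dense_range_meets_open[OF dense U] .
  obtain j where j: "int_iterate (topspace X) f j x \<in> V"
    using dense_range_meets_open[OF dense V] .
  show ?thesis
  proof (cases "i \<le> j")
    case True
    then have "(f ^^ nat (j - i)) (int_iterate (topspace X) f i x) \<in> V"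
      using j by (simp only: int_iterate_add[OF bij x True])
    then show ?thesis using i by blast
  next
    case False
    define q k where "q = int_iterate (topspace X) f j x" and "k = nat (i - j)"
    have q: "q \<in> V" "(f ^^ k) q \<in> U"
      using i j False int_iterate_add[OF bij x, of j i] by (auto simp: q_def k_def)
    define W where "W = V \<inter> {x \<in> topspace X. (f ^^ k) x \<in> U}"
    have "openin X W"
      unfolding W_def
      using U V openin_continuous_map_preimage[OF continuous_map_funpow[OF cont]] by blast
    moreover have "q \<in> W"
      using q V openin_subset unfolding W_def by blast
    \<comment> \<open>A return no earlier than time \<open>k\<close> leaves \<open>n - k\<close>
      steps from the visit in \<open>U\<close> to the arrival in \<open>V\<close>.\<close>
    ultimately obtain n w where n: "n \<ge> k" "w \<in> W" "(f ^^ n) w \<in> W"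
      using non_wandering_late_return[OF nw cont] by blast
    have "(f ^^ (n - k)) ((f ^^ k) w) = (f ^^ n) w"
      using n(1) funpow_add[of "n - k" k f] by simp
    then have "(f ^^ (n - k)) ((f ^^ k) w) \<in> V" "(f ^^ k) w \<in> U"
      using n unfolding W_def by auto
    then show ?thesis by blast
  qed
qed

section \<open>Baire category and uniform continuity on compact metric spaces\<close>

text \<open>Birkhoff's transitivity theorem: the points whose forward orbit hits a given ball form
  an open set, dense by transitivity, and Baire's theorem gives a point in countably many of these
  sets at once.\<close>

lemma (in Metric_space) transitive_imp_dense_forward_orbit:
  assumes compact: "compact_space mtopology" and cont: "continuous_map mtopology mtopology f"
    and "M \<noteq> {}"
    and trans: "\<And>U V. \<lbrakk>openin mtopology U; U \<noteq> {}; openin mtopology V; V \<noteq> {}\<rbrakk>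
                  \<Longrightarrow> \<exists>n. \<exists>x\<in>U. (f ^^ n) x \<in> V"
  shows "has_dense_forward_orbit mtopology f"
proof -
  have "\<forall>n. \<exists>C. finite C \<and> C \<subseteq> M \<and> M \<subseteq> (\<Union>x\<in>C. mball x (1 / real (Suc n)))"
    using compact unfolding compact_space_eq_mcomplete_mtotally_bounded mtotally_bounded_def by simp
  then obtain C where C: "\<And>n. finite (C n)" "\<And>n. C n \<subseteq> M"
      "\<And>n. M \<subseteq> (\<Union>x\<in>C n. mball x (1 / real (Suc n)))"
    by metis
  define hits where "hits V = {x \<in> M. \<exists>k. (f ^^ k) x \<in> V}" for V
  \<comment> \<open>The balls around the finite nets \<open>C n\<close> play the role of a countable
    base.\<close>
  define \<G> where "\<G> = (\<Union>n. (\<lambda>x. hits (mball x (1 / real (Suc n)))) ` C n)"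
  have "countable \<G>"
    unfolding \<G>_def by (intro countable_UN) (auto intro: countable_finite C)
  moreover have "openin mtopology T \<and> mtopology closure_of T = M" if "T \<in> \<G>" for T
  proof
    obtain n x where T: "T = hits (mball x (1 / real (Suc n)))" and x: "x \<in> M"
      using \<open>T \<in> \<G>\<close> C(2) unfolding \<G>_def by blast
    let ?V = "mball x (1 / real (Suc n))"
    have "T = (\<Union>k. {x \<in> topspace mtopology. (f ^^ k) x \<in> ?V})"
      unfolding T hits_def by auto
    moreover have "openin mtopology {x \<in> topspace mtopology. (f ^^ k) x \<in> ?V}" for k
      by (rule openin_continuous_map_preimage[OF continuous_map_funpow[OF cont]]) simp
    ultimately show "openin mtopology T"
      by auto
    have "x \<in> ?V" using x by simp
    then have V: "?V \<noteq> {}" by blast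
    have "T \<inter> U \<noteq> {}" if U: "openin mtopology U" "U \<noteq> {}" for U
    proof -
      obtain k u where "u \<in> U" "(f ^^ k) u \<in> ?V"
        using trans[OF U openin_mball V] by blast
      moreover have "u \<in> M"
        using \<open>u \<in> U\<close> openin_subset[OF U(1)] by auto
      ultimately show ?thesis unfolding T hits_def by blast
    qed
    then show "mtopology closure_of T = M"
      using dense_intersects_open[of mtopology T] by simp
  qed
  ultimately have "mtopology closure_of \<Inter>\<G> = M"
    using metric_Baire_category compact_space_imp_mcomplete[OF compact] by blast
  then have "\<Inter>\<G> \<inter> M \<noteq> {}"
    using dense_intersects_open[of mtopology "\<Inter>\<G>"] \<open>M \<noteq> {}\<close> openin_topspace[of mtopology]
    by (metis topspace_mtopology)
  then obtain x where x: "x \<in> M" "\<And>T. T \<in> \<G> \<Longrightarrow> x \<in> T"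
    by blast
  have dense: "\<exists>n. (f ^^ n) x \<in> U" if U: "openin mtopology U" "U \<noteq> {}" for U
  proof -
    obtain u r where u: "u \<in> U" "r > 0" "mball u r \<subseteq> U" "u \<in> M"
      using U unfolding openin_mtopology by blast
    \<comment> \<open>Half of \<open>r\<close>, since the orbit point is reached from
      \<open>u\<close> through the centre \<open>c\<close>, in two steps shorter than
      \<open>1 / real (Suc n)\<close>.\<close>
    obtain n where n: "1 / real (Suc n) < r / 2"
      using u(2) nat_approx_posE[of "r / 2"] by auto
    obtain c where c: "c \<in> C n" "d c u < 1 / real (Suc n)"
      using C(3)[of n] u(4) by auto
    have "hits (mball c (1 / real (Suc n))) \<in> \<G>"
      using c(1) unfolding \<G>_def by blast
    then obtain k where k: "(f ^^ k) x \<in> mball c (1 / real (Suc n))"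
      using x(2) unfolding hits_def by blast
    then have "d u ((f ^^ k) x) < r"
      using c n u(4) triangle[of u c "(f ^^ k) x"] commute[of c u] by simp
    then have "(f ^^ k) x \<in> U"
      using u k by auto
    then show ?thesis by blast
  qed
  show ?thesis
    unfolding has_dense_forward_orbit_def
    using x(1) dense_rangeI[of mtopology "\<lambda>n. (f ^^ n) x"] dense by auto
qed

text \<open>The Heine-Cantor theorem: \<delta> is a Lebesgue number of the cover by preimages of
  balls of radius \<open>\<eta> / 2\<close>.\<close>

lemma (in Metric_space) compact_uniformly_continuous:
  assumes compact: "compact_space mtopology" and cont: "continuous_map mtopology mtopology f"
    and "\<eta> > 0"
  shows "\<exists>\<delta>>0. \<forall>x\<in>M. \<forall>y\<in>M. d x y < \<delta> \<longrightarrow> d (f x) (f y) < \<eta>"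
proof -
  define U where "U c = {x \<in> topspace mtopology. f x \<in> mball c (\<eta> / 2)}" for c
  have "\<exists>\<epsilon>>0. \<forall>x \<in> M. \<exists>T \<in> U ` M. mball x \<epsilon> \<subseteq> T"
  proof (rule lebesgue_number)
    show "compactin mtopology M"
      using compact by (simp add: compact_space_def)
    show "M \<subseteq> \<Union> (U ` M)"
    proof
      fix x assume "x \<in> M"
      then have "f x \<in> M"
        using cont continuous_map_image_subset_topspace by fastforce
      then show "x \<in> \<Union> (U ` M)"
        using \<open>x \<in> M\<close> \<open>\<eta> > 0\<close> unfolding U_def by (auto intro!: bexI[of _ "f x"])
    qed
    show "openin mtopology T" if T: "T \<in> U ` M" for T
    proof -
      obtain c where "T = U c" using T by blast
      then show ?thesis
        using openin_continuous_map_preimage[OF cont openin_mball] unfolding U_def by metis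
    qed
  qed
  then obtain \<delta> where \<delta>: "\<delta> > 0" "\<And>x. x \<in> M \<Longrightarrow> \<exists>c\<in>M. mball x \<delta> \<subseteq> U c"
    by auto
  have "d (f x) (f y) < \<eta>" if xy: "x \<in> M" "y \<in> M" "d x y < \<delta>" for x y
  proof -
    obtain c where "c \<in> M" and c: "mball x \<delta> \<subseteq> U c"
      using \<delta>(2) xy by blast
    moreover have "x \<in> mball x \<delta>" "y \<in> mball x \<delta>"
      using xy \<delta>(1) by auto
    ultimately have "f x \<in> mball c (\<eta> / 2)" "f y \<in> mball c (\<eta> / 2)"
      unfolding U_def by blast+
    then show ?thesis
      using triangle[of "f x" c "f y"] commute[of c "f x"] by simp
  qed
  then show ?thesis using \<delta>(1) by blast
qed

text \<open>Coordinates in the inverse limit are images of later ones, so a common \<delta> for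
  finitely many iterates carries closeness at one coordinate to the earlier ones.\<close>

lemma (in Metric_space) funpow_uniformly_continuous:
  assumes compact: "compact_space mtopology" and cont: "continuous_map mtopology mtopology f"
    and "\<eta> > 0"
  shows "\<exists>\<delta>>0. \<forall>x\<in>M. \<forall>y\<in>M. d x y < \<delta> \<longrightarrow> (\<forall>i\<le>N. d ((f ^^ i) x) ((f ^^ i) y) < \<eta>)"
proof (induction N)
  case 0
  then show ?case using \<open>\<eta> > 0\<close> by auto
next
  case (Suc N)
  then obtain \<delta> where \<delta>: "\<delta> > 0"
      "\<forall>x\<in>M. \<forall>y\<in>M. d x y < \<delta> \<longrightarrow> (\<forall>i\<le>N. d ((f ^^ i) x) ((f ^^ i) y) < \<eta>)"
    by blast
  obtain \<delta>' where \<delta>': "\<delta>' > 0"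
      "\<forall>x\<in>M. \<forall>y\<in>M. d x y < \<delta>' \<longrightarrow> d ((f ^^ Suc N) x) ((f ^^ Suc N) y) < \<eta>"
    using compact_uniformly_continuous[OF compact continuous_map_funpow[OF cont] \<open>\<eta> > 0\<close>] by blast
  show ?case
    using \<delta> \<delta>' by (intro exI[of _ "min \<delta> \<delta>'"]) (auto simp: le_Suc_eq)
qed

section \<open>The inverse limit as a compact metric space\<close>

locale wieler_system = Metric_space Y d for Y :: "'a set" and d :: "'a \<Rightarrow> 'a \<Rightarrow> real" +
  fixes g :: "'a \<Rightarrow> 'a" and \<beta> \<gamma> :: real and K :: nat
  assumes compact: "compact_space mtopology"
    and cont: "continuous_map mtopology mtopology g"
    and surj: "g ` Y = Y"
    and \<beta>_pos: "\<beta> > 0" and K_pos: "K \<ge> 1" and \<gamma>_pos: "0 < \<gamma>" and \<gamma>_less_1: "\<gamma> < 1"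
    and ax1: "axiom1 Y d g \<beta> K \<gamma>"
    and ax2: "axiom2 Y d g \<beta> K \<gamma>"
begin

abbreviation "L \<equiv> inv_limit Y g"
abbreviation "F \<equiv> shift_map g"
abbreviation "B \<equiv> inv_into L F"
abbreviation "D \<equiv> hat_dist Y d g K \<gamma>"
text \<open>On \<open>L\<close> this is the explicit form of \<open>B ^^ k\<close>, as
  \<open>inv_shift_funpow\<close> shows.\<close>

abbreviation tail :: "nat \<Rightarrow> (nat \<Rightarrow> 'a) \<Rightarrow> nat \<Rightarrow> 'a" where "tail k x \<equiv> (\<lambda>n. x (n + k))"

section \<open>Coordinates, the shift and its inverse\<close>

lemma funpow_mem: "y \<in> Y \<Longrightarrow> (g ^^ n) y \<in> Y"
  using surj by (induction n) auto

lemma limitI: "(\<And>n. x n \<in> Y) \<Longrightarrow> (\<And>n. g (x (Suc n)) = x n) \<Longrightarrow> x \<in> L"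
  unfolding inv_limit_def mem_Collect_eq by metis

lemma limit_mem: "x \<in> L \<Longrightarrow> x n \<in> Y"
  unfolding inv_limit_def by blast

lemma limit_step: "x \<in> L \<Longrightarrow> g (x (Suc n)) = x n"
  unfolding inv_limit_def mem_Collect_eq by metis

lemma limit_funpow: "x \<in> L \<Longrightarrow> (g ^^ k) (x (n + k)) = x n"
  by (induction k) (auto simp: limit_step funpow_swap1)

lemma limit_funpow': "x \<in> L \<Longrightarrow> n \<le> m \<Longrightarrow> (g ^^ (m - n)) (x m) = x n"
  using limit_funpow[of x "m - n" n] by simp

lemma shift_mem: "x \<in> L \<Longrightarrow> F x \<in> L"
  using surj limit_mem by (intro limitI) (auto simp: shift_map_def limit_step)

lemma shift_funpow_mem: "x \<in> L \<Longrightarrow> (F ^^ n) x \<in> L"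
  by (induction n) (auto simp: shift_mem)

lemma tail_mem: "x \<in> L \<Longrightarrow> tail k x \<in> L"
  by (intro limitI) (auto simp: limit_mem limit_step)

lemma shift_funpow: "(F ^^ n) x m = (g ^^ n) (x m)"
  by (induction n) (auto simp: shift_map_def)

lemma shift_funpow_shift: "x \<in> L \<Longrightarrow> (F ^^ n) x (m + n) = x m"
  by (simp add: shift_funpow limit_funpow)

lemma shift_tail: "x \<in> L \<Longrightarrow> F (tail 1 x) = x"
  by (simp add: shift_map_def fun_eq_iff limit_step)

text \<open>On \<open>L\<close> the shift only prepends a coordinate:
  \<open>F x (Suc n) = x n\<close>, so \<open>F x\<close> determines \<open>x\<close>.\<close>

lemma shift_inj: "inj_on F L"
proof (rule inj_onI)
  fix x y assume "x \<in> L" "y \<in> L" "F x = F y"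
  then have "x n = y n" for n
    using limit_step[of x n] limit_step[of y n] by (metis shift_map_def)
  then show "x = y" by blast
qed

lemma shift_image: "F ` L = L"
proof
  show "L \<subseteq> F ` L"
    using shift_tail tail_mem by (metis imageI subsetI)
qed (use shift_mem in auto)

lemma inv_shift: "x \<in> L \<Longrightarrow> B x = tail 1 x"
  by (rule inv_into_f_eq[OF shift_inj]) (simp_all only: tail_mem shift_tail)

lemma inv_shift_funpow: "x \<in> L \<Longrightarrow> (B ^^ k) x = tail k x"
proof (induction k)
  case (Suc k)
  then show ?case using inv_shift[OF tail_mem[of x k]] by (simp add: add.commute)
qed simp

text \<open>Iterating a right inverse of \<open>g\<close> gives a point of \<open>L\<close> that
  starts at \<open>y\<close>, and \<open>F ^^ n\<close> moves coordinate 0 to coordinate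
  \<open>n\<close>. Thus every coordinate projection is onto \<open>Y\<close>.\<close>

lemma limit_through:
  assumes "y \<in> Y"
  obtains x where "x \<in> L" "x n = y"
proof -
  obtain s where s: "\<And>a. a \<in> Y \<Longrightarrow> s a \<in> Y \<and> g (s a) = a"
    using surj by (metis (no_types, lifting) image_iff)
  have "(s ^^ m) y \<in> Y" for m
    using s assms by (induction m) auto
  then have "(\<lambda>m. (s ^^ m) y) \<in> L"
    using s by (intro limitI) auto
  then have "(F ^^ n) (\<lambda>m. (s ^^ m) y) \<in> L" "(F ^^ n) (\<lambda>m. (s ^^ m) y) n = y"
    using shift_funpow_mem shift_funpow_shift[of "\<lambda>m. (s ^^ m) y" n 0] by auto
  then show ?thesis using that by blast
qed

section \<open>The metric on the inverse limit\<close>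

lemma diameter:
  obtains C where "C > 0" "\<And>x y. x \<in> Y \<Longrightarrow> y \<in> Y \<Longrightarrow> d x y \<le> C"
  using compactin_imp_mbounded[of Y] compact by (auto simp: compact_space_def mbounded_alt_pos)

text \<open>The compact space \<open>Y\<close> is bounded and \<open>\<gamma> ^ n \<le> 1\<close>,
  so the supremum is taken over a bounded set.\<close>

lemma sup_dist_upper:
  assumes "x \<in> L" "y \<in> L"
  shows "\<gamma> ^ n * d (x n) (y n) \<le> sup_dist d \<gamma> x y"
proof -
  obtain C where C: "C > 0" "\<And>x y. x \<in> Y \<Longrightarrow> y \<in> Y \<Longrightarrow> d x y \<le> C"
    using diameter by blast
  have "\<gamma> ^ n * d (x n) (y n) \<le> 1 * C" for n
    using C assms limit_mem \<gamma>_pos \<gamma>_less_1 by (intro mult_mono) (auto simp: power_le_one)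
  then have "bdd_above (range (\<lambda>n. \<gamma> ^ n * d (x n) (y n)))"
    by (auto intro!: bdd_aboveI2)
  then show ?thesis
    unfolding sup_dist_def by (rule cSUP_upper[OF UNIV_I])
qed

lemma sup_dist_least: "(\<And>n. \<gamma> ^ n * d (x n) (y n) \<le> c) \<Longrightarrow> sup_dist d \<gamma> x y \<le> c"
  unfolding sup_dist_def by (simp add: cSUP_least)

lemma sup_dist_nonneg: "x \<in> L \<Longrightarrow> y \<in> L \<Longrightarrow> 0 \<le> sup_dist d \<gamma> x y"
  using sup_dist_upper[of x y 0] order_trans[OF nonneg[of "x 0" "y 0"], of "sup_dist d \<gamma> x y"] by simp

lemma hat_dist_eq:
  assumes "x \<in> L" "y \<in> L"
  shows "D x y = (\<Sum>k<K. (1 / \<gamma>) ^ k * sup_dist d \<gamma> (tail k x) (tail k y))"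
  using assms
  by (simp add: hat_dist_def inv_shift_funpow power_int_minus power_one_over inverse_eq_divide)

lemma coordinate_le_hat_dist:
  assumes "x \<in> L" "y \<in> L"
  shows "\<gamma> ^ n * d (x n) (y n) \<le> D x y"
proof -
  have "\<gamma> ^ n * d (x n) (y n) \<le> (1 / \<gamma>) ^ 0 * sup_dist d \<gamma> (tail 0 x) (tail 0 y)"
    using sup_dist_upper[OF assms] by simp
  also have "\<dots> \<le> D x y"
    unfolding hat_dist_eq[OF assms]
    using K_pos \<gamma>_pos assms
    by (intro member_le_sum) (auto intro!: mult_nonneg_nonneg sup_dist_nonneg tail_mem)
  finally show ?thesis .
qed

lemma hat_dist_scaled:
  assumes "u \<in> L" "v \<in> L" "x \<in> L" "y \<in> L"
    and "\<And>k. k < K \<Longrightarrow>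
      sup_dist d \<gamma> (tail k u) (tail k v) \<le> c * sup_dist d \<gamma> (tail k x) (tail k y)"
  shows "D u v \<le> c * D x y"
  unfolding hat_dist_eq[OF assms(1,2)] hat_dist_eq[OF assms(3,4)] sum_distrib_left
proof (rule sum_mono)
  fix k assume "k \<in> {..<K}"
  then have "(1 / \<gamma>) ^ k * sup_dist d \<gamma> (tail k u) (tail k v)
      \<le> (1 / \<gamma>) ^ k * (c * sup_dist d \<gamma> (tail k x) (tail k y))"
    using assms(5) \<gamma>_pos by (intro mult_left_mono) auto
  then show "(1 / \<gamma>) ^ k * sup_dist d \<gamma> (tail k u) (tail k v)
      \<le> c * ((1 / \<gamma>) ^ k * sup_dist d \<gamma> (tail k x) (tail k y))"
    by (simp add: mult.left_commute)
qed

text \<open>The total mass of the factors in \<open>hat_dist\<close>; it turns a uniform bound on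
  the terms into a bound on \<open>D\<close>.\<close>

definition weight :: real where "weight = (\<Sum>k<K. (1 / \<gamma>) ^ k)"

lemma weight_pos: "weight > 0"
  unfolding weight_def using K_pos \<gamma>_pos by (intro sum_pos) (auto simp: lessThan_empty_iff)

text \<open>For \<open>n \<le> N\<close> the coordinate \<open>n + k\<close> with
  \<open>k < K\<close> is covered by the bound on initial coordinates; for larger \<open>n\<close>
  the factor \<open>\<gamma> ^ n\<close> is at most \<open>\<gamma> ^ N\<close>, which makes any
  distance small.\<close>

lemma hat_dist_le_of_initial:
  assumes "x \<in> L" "y \<in> L" "\<And>n. n \<le> N + K \<Longrightarrow> d (x n) (y n) \<le> \<eta>"
    and "\<And>a b. a \<in> Y \<Longrightarrow> b \<in> Y \<Longrightarrow> \<gamma> ^ N * d a b \<le> \<eta>"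
  shows "D x y \<le> weight * \<eta>"
  unfolding hat_dist_eq[OF assms(1,2)] weight_def sum_distrib_right
proof (intro sum_mono mult_left_mono sup_dist_least)
  fix k n assume "k \<in> {..<K}"
  show "\<gamma> ^ n * d (x (n + k)) (y (n + k)) \<le> \<eta>"
  proof (cases "n \<le> N")
    case True
    have "\<gamma> ^ n * d (x (n + k)) (y (n + k)) \<le> 1 * d (x (n + k)) (y (n + k))"
      using \<gamma>_pos \<gamma>_less_1 by (intro mult_right_mono) (auto simp: power_le_one)
    also have "\<dots> \<le> \<eta>"
      using assms(3)[of "n + k"] True \<open>k \<in> {..<K}\<close> by simp
    finally show ?thesis .
  next
    case False
    have "\<gamma> ^ n * d (x (n + k)) (y (n + k)) \<le> \<gamma> ^ N * d (x (n + k)) (y (n + k))"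
      using False \<gamma>_pos \<gamma>_less_1 by (intro mult_right_mono power_decreasing) auto
    also have "\<dots> \<le> \<eta>"
      using assms limit_mem by blast
    finally show ?thesis .
  qed
qed (use \<gamma>_pos in auto)

lemma hat_dist_le_of_all:
  assumes "x \<in> L" "y \<in> L" "\<And>n. d (x n) (y n) \<le> \<eta>"
  shows "D x y \<le> weight * \<eta>"
  unfolding hat_dist_eq[OF assms(1,2)] weight_def sum_distrib_right
proof (intro sum_mono mult_left_mono sup_dist_least)
  fix k n
  have "\<gamma> ^ n * d (x (n + k)) (y (n + k)) \<le> 1 * d (x (n + k)) (y (n + k))"
    using \<gamma>_pos \<gamma>_less_1 by (intro mult_right_mono) (auto simp: power_le_one)
  then show "\<gamma> ^ n * d (x (n + k)) (y (n + k)) \<le> \<eta>"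
    using assms(3)[of "n + k"] by simp
qed (use \<gamma>_pos in auto)

lemma hat_metric: "Metric_space L D"
proof
  fix x y
  show "0 \<le> D x y"
  proof (cases "x \<in> L \<and> y \<in> L")
    case True
    then show ?thesis
      using coordinate_le_hat_dist[of x y 0] order_trans[OF nonneg[of "x 0" "y 0"], of "D x y"] by simp
  next
    case False
    then show ?thesis by (auto simp: hat_dist_def)
  qed
  show "D x y = D y x"
    by (simp add: hat_dist_def sup_dist_def commute conj_commute)
next
  fix x y assume xy: "x \<in> L" "y \<in> L"
  have "x = y" if "D x y = 0"
  proof
    fix n
    have "\<gamma> ^ n * d (x n) (y n) \<le> 0"
      using coordinate_le_hat_dist[OF xy] that by metis
    then have "d (x n) (y n) = 0"
      using \<gamma>_pos nonneg by (smt (verit) mult_pos_pos zero_less_power)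
    then show "x n = y n"
      using xy limit_mem by auto
  qed
  moreover have "D x x = 0"
    using xy limit_mem by (simp add: hat_dist_eq sup_dist_def)
  ultimately show "D x y = 0 \<longleftrightarrow> x = y" by blast
next
  fix x y z assume L: "x \<in> L" "y \<in> L" "z \<in> L"
  have "sup_dist d \<gamma> (tail k x) (tail k z)
      \<le> sup_dist d \<gamma> (tail k x) (tail k y) + sup_dist d \<gamma> (tail k y) (tail k z)" for k
  proof (rule sup_dist_least)
    fix n
    have "\<gamma> ^ n * d (tail k x n) (tail k z n)
        \<le> \<gamma> ^ n * (d (tail k x n) (tail k y n) + d (tail k y n) (tail k z n))"
      using \<gamma>_pos L limit_mem by (intro mult_left_mono triangle) auto
    also have "\<dots> \<le> sup_dist d \<gamma> (tail k x) (tail k y) + sup_dist d \<gamma> (tail k y) (tail k z)"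
      unfolding distrib_left by (intro add_mono sup_dist_upper tail_mem L)
    finally show "\<gamma> ^ n * d (tail k x n) (tail k z n)
      \<le> sup_dist d \<gamma> (tail k x) (tail k y) + sup_dist d \<gamma> (tail k y) (tail k z)" .
  qed
  then have "D x z \<le> (\<Sum>k<K. (1 / \<gamma>) ^ k *
      (sup_dist d \<gamma> (tail k x) (tail k y) + sup_dist d \<gamma> (tail k y) (tail k z)))"
    unfolding hat_dist_eq[OF L(1,3)] using \<gamma>_pos by (intro sum_mono mult_left_mono) auto
  then show "D x z \<le> D x y + D y z"
    by (simp add: hat_dist_eq L distrib_left sum.distrib)
qed

sublocale hat: Metric_space L D
  by (rule hat_metric)

text \<open>A single coordinate, far enough out, controls the distance, since it determines all earlier ones.\<close>

lemma hat_dist_small_of_coordinate: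
  assumes x: "x \<in> L" and "r > 0"
  shows "\<exists>n. \<exists>\<rho>>0. \<forall>y\<in>L. d (x n) (y n) < \<rho> \<longrightarrow> D x y < r"
proof -
  obtain C where C: "C > 0" "\<And>x y. x \<in> Y \<Longrightarrow> y \<in> Y \<Longrightarrow> d x y \<le> C"
    using diameter by blast
  define \<eta> where "\<eta> = r / (2 * weight)"
  have \<eta>: "\<eta> > 0" "weight * \<eta> < r"
    using weight_pos \<open>r > 0\<close> by (auto simp: \<eta>_def)
  \<comment> \<open>This \<open>N\<close> brings \<open>\<gamma> ^ N\<close> times any distance in
    \<open>Y\<close> below \<eta>, so that only coordinates up to \<open>N + K\<close> remain to be
    controlled.\<close>
  obtain N where N: "\<gamma> ^ N < \<eta> / C"
    using real_arch_pow_inv[of "\<eta> / C" \<gamma>] \<eta> C \<gamma>_less_1 by auto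
  have small: "\<gamma> ^ N * d a b \<le> \<eta>" if "a \<in> Y" "b \<in> Y" for a b
  proof -
    have "\<gamma> ^ N * d a b \<le> \<gamma> ^ N * C"
      using C that \<gamma>_pos by (intro mult_left_mono) auto
    then show ?thesis using N C by (simp add: field_simps)
  qed
  obtain \<rho> where \<rho>: "\<rho> > 0"
      "\<forall>a\<in>Y. \<forall>b\<in>Y. d a b < \<rho> \<longrightarrow> (\<forall>i\<le>N + K. d ((g ^^ i) a) ((g ^^ i) b) < \<eta>)"
    using funpow_uniformly_continuous[OF compact cont \<eta>(1)] by blast
  have "D x y < r" if y: "y \<in> L" "d (x (N + K)) (y (N + K)) < \<rho>" for y
  proof -
    have "d (x n) (y n) \<le> \<eta>" if "n \<le> N + K" for n
    proof -
      have "d ((g ^^ (N + K - n)) (x (N + K))) ((g ^^ (N + K - n)) (y (N + K))) < \<eta>"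
        using \<rho>(2) x y limit_mem by (meson diff_le_self)
      then show ?thesis
        using limit_funpow'[OF x that] limit_funpow'[OF y(1) that] by simp
    qed
    then have "D x y \<le> weight * \<eta>"
      using hat_dist_le_of_initial[OF x y(1)] small by blast
    then show ?thesis using \<eta> by simp
  qed
  then show ?thesis using \<rho>(1) by blast
qed

section \<open>Topology and compactness of the inverse limit\<close>

lemma continuous_map_coordinate: "continuous_map hat.mtopology mtopology (\<lambda>x. x n)"
  unfolding hat.metric_continuous_map[OF Metric_space_axioms]
proof (intro conjI ballI allI impI)
  show "(\<lambda>x. x n) ` L \<subseteq> Y" using limit_mem by blast
  fix a and \<epsilon> :: real assume a: "a \<in> L" "\<epsilon> > 0"
  have "d (a n) (x n) < \<epsilon>" if "x \<in> L" "D a x < \<gamma> ^ n * \<epsilon>" for x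
  proof -
    have "\<gamma> ^ n * d (a n) (x n) < \<gamma> ^ n * \<epsilon>"
      using coordinate_le_hat_dist[OF a(1) that(1), of n] that(2) by linarith
    then show ?thesis using \<gamma>_pos by simp
  qed
  then show "\<exists>\<delta>>0. \<forall>x. x \<in> L \<and> D a x < \<delta> \<longrightarrow> d (a n) (x n) < \<epsilon>"
    using a \<gamma>_pos by (intro exI[of _ "\<gamma> ^ n * \<epsilon>"]) auto
qed

text \<open>Together with \<open>continuous_map_coordinate\<close> this says that \<open>D\<close>
  induces the topology of coordinatewise convergence. Near a given point one coordinate suffices, by
  \<open>hat_dist_small_of_coordinate\<close>.\<close>

lemma continuous_map_into_limit:
  assumes "\<And>t. t \<in> topspace T \<Longrightarrow> h t \<in> L" and "\<And>n. continuous_map T mtopology (\<lambda>t. h t n)"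
  shows "continuous_map T hat.mtopology h"
  unfolding hat.continuous_map_to_metric
proof (intro ballI allI impI)
  fix t and \<epsilon> :: real assume t: "t \<in> topspace T" "\<epsilon> > 0"
  obtain n \<rho> where \<rho>: "\<rho> > 0" "\<forall>y\<in>L. d (h t n) (y n) < \<rho> \<longrightarrow> D (h t) y < \<epsilon>"
    using hat_dist_small_of_coordinate[OF assms(1)[OF t(1)] t(2)] by blast
  let ?U = "{s \<in> topspace T. h s n \<in> mball (h t n) \<rho>}"
  have "openin T ?U"
    by (rule openin_continuous_map_preimage[OF assms(2)]) simp
  moreover have "t \<in> ?U"
    using t \<rho>(1) assms(1) limit_mem by auto
  moreover have "h s \<in> hat.mball (h t) \<epsilon>" if "s \<in> ?U" for s
    using that \<rho>(2) assms(1) t by auto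
  ultimately show "\<exists>U. openin T U \<and> t \<in> U \<and> (\<forall>y\<in>U. h y \<in> hat.mball (h t) \<epsilon>)"
    by blast
qed

text \<open>Preimages of open sets under single coordinates form a base, which is how dynamical
  properties of \<open>g\<close> are later lifted to \<open>F\<close>.\<close>

lemma limit_open_contains_coordinate_open:
  assumes "openin hat.mtopology W" "x \<in> W"
  obtains n U where "openin mtopology U" "x n \<in> U" "\<And>y. y \<in> L \<Longrightarrow> y n \<in> U \<Longrightarrow> y \<in> W"
proof -
  obtain r where r: "r > 0" "hat.mball x r \<subseteq> W" and x: "x \<in> L"
    using assms unfolding hat.openin_mtopology by blast
  obtain n \<rho> where \<rho>: "\<rho> > 0" "\<forall>y\<in>L. d (x n) (y n) < \<rho> \<longrightarrow> D x y < r"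
    using hat_dist_small_of_coordinate[OF x r(1)] by blast
  show ?thesis
  proof (rule that[of "mball (x n) \<rho>" n])
    show "y \<in> W" if "y \<in> L" "y n \<in> mball (x n) \<rho>" for y
      using that \<rho>(2) r(2) x by auto
  qed (use \<rho>(1) x limit_mem in auto)
qed

text \<open>By Tychonoff's theorem the product is compact, and \<open>L\<close> is closed in it as
  an intersection of equalizers. The identity from the product topology on \<open>L\<close> to the
  metric topology is continuous and transports compactness.\<close>

lemma limit_compact: "compact_space hat.mtopology"
proof -
  let ?P = "product_topology (\<lambda>_::nat. mtopology) UNIV"
  have P: "topspace ?P = {x. \<forall>n. x n \<in> Y}"
    by (auto simp: PiE_def extensional_def)
  have coord: "continuous_map ?P mtopology (\<lambda>x. x n)" for n
    using continuous_map_product_coordinates[of n UNIV "\<lambda>_. mtopology"] by simp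
  have "closedin ?P {x \<in> topspace ?P. x n = g (x (Suc n))}" for n
    using closedin_continuous_maps_eq[OF Hausdorff_space_mtopology coord
        continuous_map_compose[OF coord cont], of n "Suc n"]
    by (simp only: o_def)
  then have "closedin ?P (\<Inter>n. {x \<in> topspace ?P. x n = g (x (Suc n))})"
    by (intro closedin_INT) auto
  also have "(\<Inter>n. {x \<in> topspace ?P. x n = g (x (Suc n))}) = L"
    unfolding P inv_limit_def by auto
  finally have "closedin ?P L" .
  moreover have "compact_space ?P"
    using compact by (simp add: compact_space_product_topology)
  ultimately have "compactin ?P L"
    by (rule closedin_compact_space[rotated])
  then have c: "compact_space (subtopology ?P L)"
    by (simp add: compact_space_subtopology)
  have L: "topspace (subtopology ?P L) = L"
    using limit_mem P by auto
  have "continuous_map (subtopology ?P L) hat.mtopology (\<lambda>x. x)"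
    by (rule continuous_map_into_limit)
       (use L coord in \<open>auto intro: continuous_map_from_subtopology\<close>)
  then have "compactin hat.mtopology ((\<lambda>x. x) ` L)"
    using c L image_compactin unfolding compact_space_def by metis
  then show ?thesis
    by (simp add: compact_space_def)
qed

lemma shift_homeomorphic: "homeomorphic_map hat.mtopology hat.mtopology F"
proof (rule continuous_imp_homeomorphic_map)
  show "continuous_map hat.mtopology hat.mtopology F"
  proof (rule continuous_map_into_limit)
    show "continuous_map hat.mtopology mtopology (\<lambda>x. F x n)" for n
      using continuous_map_compose[OF continuous_map_coordinate cont] by (simp add: shift_map_def o_def)
  qed (simp add: shift_mem)
qed (simp_all add: limit_compact hat.Hausdorff_space_mtopology shift_image shift_inj)

lemma limit_compact_metric_homeo: "compact_metric_homeo L D F"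
  unfolding compact_metric_homeo_def
  using hat_metric limit_compact shift_homeomorphic by blast

section \<open>Local stable and unstable sets\<close>

text \<open>Axiom 1 is applied to the coordinates of index \<open>n + 2 * K\<close>; their images
  under \<open>g ^^ K\<close> and \<open>g ^^ (2 * K)\<close> are the coordinates
  \<open>n + K\<close> and \<open>n\<close>.\<close>

lemma axiom1_coordinates:
  assumes "x \<in> L" "y \<in> L" "d (x (n + 2 * K)) (y (n + 2 * K)) \<le> \<beta>"
  shows "d (x (n + K)) (y (n + K)) \<le> \<gamma> ^ K * d (x n) (y n)"
  using ax1 assms limit_mem limit_funpow[of x "2 * K" n] limit_funpow[of y "2 * K" n]
    limit_funpow[of x K "n + K"] limit_funpow[of y K "n + K"]
  unfolding axiom1_def by (metis add.assoc mult_2)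

text \<open>The bound cancels the factor \<open>\<gamma> ^ (2 * K)\<close> of coordinate
  \<open>2 * K\<close>, so Axiom 1 applies along the whole forward orbit. It bounds the distance at
  coordinate \<open>K\<close> by \<open>\<gamma> ^ K\<close> times the same distance
  \<open>K\<close> shifts later, and boundedness of \<open>Y\<close> forces it to vanish.\<close>

lemma stable_coordinate_eq:
  assumes x: "x \<in> L" and y: "y \<in> L" and close: "\<And>n. D ((F ^^ n) x) ((F ^^ n) y) \<le> \<beta> * \<gamma> ^ (2 * K)"
  shows "x K = y K"
proof -
  have close': "d ((F ^^ n) x (2 * K)) ((F ^^ n) y (2 * K)) \<le> \<beta>" for n
  proof -
    have "\<gamma> ^ (2 * K) * d ((F ^^ n) x (2 * K)) ((F ^^ n) y (2 * K)) \<le> \<beta> * \<gamma> ^ (2 * K)"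
      using coordinate_le_hat_dist[of "(F ^^ n) x" "(F ^^ n) y" "2 * K"] close[of n]
        shift_funpow_mem x y by (meson order_trans)
    then show ?thesis using \<gamma>_pos by (simp add: mult.commute)
  qed
  have expand: "d (x K) (y K) \<le> (\<gamma> ^ K) ^ j * d ((F ^^ (j * K)) x K) ((F ^^ (j * K)) y K)" for j
  proof (induction j)
    case (Suc j)
    have "d ((F ^^ (j * K)) x (0 + K)) ((F ^^ (j * K)) y (0 + K))
        \<le> \<gamma> ^ K * d ((F ^^ (j * K)) x 0) ((F ^^ (j * K)) y 0)"
      by (rule axiom1_coordinates) (use x y shift_funpow_mem close' in auto)
    \<comment> \<open>Coordinate 0 reappears as coordinate \<open>K\<close> after \<open>K\<close>
      more shifts, which makes the estimate iterable.\<close>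
    moreover have "(F ^^ (j * K)) u 0 = (F ^^ (Suc j * K)) u K" if "u \<in> L" for u
      using shift_funpow_shift[OF shift_funpow_mem[OF that], of K "j * K" 0]
      by (simp add: funpow_add)
    ultimately have "d ((F ^^ (j * K)) x K) ((F ^^ (j * K)) y K)
        \<le> \<gamma> ^ K * d ((F ^^ (Suc j * K)) x K) ((F ^^ (Suc j * K)) y K)"
      using x y by simp
    then have "(\<gamma> ^ K) ^ j * d ((F ^^ (j * K)) x K) ((F ^^ (j * K)) y K)
        \<le> (\<gamma> ^ K) ^ j * (\<gamma> ^ K * d ((F ^^ (Suc j * K)) x K) ((F ^^ (Suc j * K)) y K))"
      using \<gamma>_pos by (intro mult_left_mono) auto
    then show ?case
      using Suc.IH by (simp add: mult.assoc mult.left_commute)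
  qed simp
  obtain C where C: "C > 0" "\<And>x y. x \<in> Y \<Longrightarrow> y \<in> Y \<Longrightarrow> d x y \<le> C"
    using diameter by blast
  have "d (x K) (y K) \<le> (\<gamma> ^ K) ^ j * C" for j
  proof -
    have "(\<gamma> ^ K) ^ j * d ((F ^^ (j * K)) x K) ((F ^^ (j * K)) y K) \<le> (\<gamma> ^ K) ^ j * C"
      using C x y limit_mem shift_funpow_mem \<gamma>_pos by (intro mult_left_mono) auto
    then show ?thesis using expand[of j] by linarith
  qed
  moreover have "(\<lambda>j. (\<gamma> ^ K) ^ j * C) \<longlonglongrightarrow> 0 * C"
    using \<gamma>_pos \<gamma>_less_1 K_pos by (intro tendsto_mult tendsto_const LIMSEQ_realpow_zero) (auto intro: power_less_one_iff[THEN iffD2])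
  ultimately have "d (x K) (y K) \<le> 0"
    by (intro LIMSEQ_le_const) auto
  then show ?thesis
    using x y limit_mem by (metis nonneg order_antisym zero)
qed

text \<open>Equality at \<open>K\<close> implies equality at every \<open>k < K\<close>, so after
  the shift the term \<open>n = 0\<close> of each supremum vanishes. The other terms are the old
  ones moved by one index, which costs a factor \<gamma>.\<close>

lemma hat_dist_shift_le:
  assumes x: "x \<in> L" and y: "y \<in> L" and eq: "x K = y K"
  shows "D (F x) (F y) \<le> \<gamma> * D x y"
proof (rule hat_dist_scaled[OF shift_mem[OF x] shift_mem[OF y] x y], rule sup_dist_least)
  fix k n assume "k < K"
  show "\<gamma> ^ n * d (tail k (F x) n) (tail k (F y) n) \<le> \<gamma> * sup_dist d \<gamma> (tail k x) (tail k y)"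
  proof (cases n)
    case 0
    have "x k = y k"
      using limit_funpow'[OF x, of k K] limit_funpow'[OF y, of k K] eq \<open>k < K\<close> by simp
    then have "d (F x k) (F y k) = 0"
      using y limit_mem shift_mem by (simp add: shift_map_def funpow_mem[of _ 1, simplified])
    then show ?thesis
      using 0 sup_dist_nonneg x y tail_mem \<gamma>_pos by simp
  next
    case (Suc m)
    have "\<gamma> ^ m * d (tail k x m) (tail k y m) \<le> sup_dist d \<gamma> (tail k x) (tail k y)"
      by (intro sup_dist_upper tail_mem x y)
    then show ?thesis
      using Suc \<gamma>_pos x y by (simp add: shift_map_def limit_step mult.assoc)
  qed
qed

lemma hat_dist_shift_funpow_le:
  assumes x: "x \<in> L" and y: "y \<in> L" and eq: "x K = y K"
  shows "D ((F ^^ n) x) ((F ^^ n) y) \<le> \<gamma> ^ n * D x y"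
proof (induction n)
  case (Suc n)
  have "D (F ((F ^^ n) x)) (F ((F ^^ n) y)) \<le> \<gamma> * D ((F ^^ n) x) ((F ^^ n) y)"
    using eq x y by (intro hat_dist_shift_le) (auto simp: shift_funpow_mem shift_funpow)
  also have "\<dots> \<le> \<gamma> * (\<gamma> ^ n * D x y)"
    using Suc \<gamma>_pos by (intro mult_left_mono) auto
  finally show ?case by (simp add: mult.assoc)
qed simp

text \<open>Each coordinate \<open>m\<close> is coordinate 0 of \<open>B ^^ m\<close>, so close
  backward orbits keep all coordinates within \<beta>, as Axiom 1 requires.\<close>

lemma unstable_coordinate_decay:
  assumes x: "x \<in> L" and y: "y \<in> L" and close: "\<And>n. D ((B ^^ n) x) ((B ^^ n) y) \<le> \<beta>"
  shows "d (x (n + K)) (y (n + K)) \<le> \<gamma> ^ K * d (x n) (y n)"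
proof (rule axiom1_coordinates[OF x y])
  show "d (x (n + 2 * K)) (y (n + 2 * K)) \<le> \<beta>"
    using coordinate_le_hat_dist[OF tail_mem[OF x] tail_mem[OF y], of 0 "n + 2 * K" "n + 2 * K"]
      close[of "n + 2 * K"] x y by (simp add: inv_shift_funpow)
qed

text \<open>The metric is adapted to contraction in blocks of \<open>K\<close> steps: applying
  \<open>B\<close> pulls out a factor \<gamma> and replaces the terms
  \<open>t 0, ..., t (K - 1)\<close> by \<open>t 1, ..., t K\<close>. The decay hypothesis says that
  the gained \<open>t K\<close> is at most the lost \<open>t 0\<close>.\<close>

lemma hat_dist_inv_shift_le:
  assumes x: "x \<in> L" and y: "y \<in> L"
    and decay: "\<And>n. d (x (n + K)) (y (n + K)) \<le> \<gamma> ^ K * d (x n) (y n)"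
  shows "D (B x) (B y) \<le> \<gamma> * D x y"
proof -
  define t where "t k = (1 / \<gamma>) ^ k * sup_dist d \<gamma> (tail k x) (tail k y)" for k
  have "sup_dist d \<gamma> (tail K x) (tail K y) \<le> \<gamma> ^ K * sup_dist d \<gamma> x y"
  proof (rule sup_dist_least)
    fix n
    have "\<gamma> ^ n * d (tail K x n) (tail K y n) \<le> \<gamma> ^ n * (\<gamma> ^ K * d (x n) (y n))"
      using decay \<gamma>_pos by (intro mult_left_mono) auto
    also have "\<dots> = \<gamma> ^ K * (\<gamma> ^ n * d (x n) (y n))"
      by simp
    also have "\<dots> \<le> \<gamma> ^ K * sup_dist d \<gamma> x y"
      using \<gamma>_pos x y by (intro mult_left_mono sup_dist_upper) auto
    finally show "\<gamma> ^ n * d (tail K x n) (tail K y n) \<le> \<gamma> ^ K * sup_dist d \<gamma> x y" .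
  qed
  then have "t K \<le> t 0"
    using \<gamma>_pos by (simp add: t_def power_one_over field_simps)
  have "D (B x) (B y) = (\<Sum>k<K. \<gamma> * t (Suc k))"
    using \<gamma>_pos x y by (simp add: inv_shift hat_dist_eq tail_mem[of _ 1, simplified] t_def)
  also have "\<dots> = \<gamma> * ((\<Sum>k<K. t k) + t K - t 0)"
    using sum.lessThan_Suc_shift[of t K] by (simp add: sum_distrib_left[symmetric])
  also have "\<dots> \<le> \<gamma> * (\<Sum>k<K. t k)"
    using \<open>t K \<le> t 0\<close> \<gamma>_pos by (intro mult_left_mono) auto
  finally show ?thesis
    using x y by (simp add: hat_dist_eq t_def)
qed

lemma hat_dist_inv_shift_funpow_le:
  assumes x: "x \<in> L" and y: "y \<in> L"
    and decay: "\<And>n. d (x (n + K)) (y (n + K)) \<le> \<gamma> ^ K * d (x n) (y n)"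
  shows "D ((B ^^ n) x) ((B ^^ n) y) \<le> \<gamma> ^ n * D x y"
proof (induction n)
  case (Suc n)
  have "D (B (tail n x)) (B (tail n y)) \<le> \<gamma> * D (tail n x) (tail n y)"
    using decay[of "_ + n"] by (intro hat_dist_inv_shift_le tail_mem x y) (simp add: ac_simps)
  also have "\<dots> \<le> \<gamma> * (\<gamma> ^ n * D x y)"
    using Suc \<gamma>_pos x y by (intro mult_left_mono) (auto simp: inv_shift_funpow)
  finally show ?case
    using x y by (simp add: mult.assoc inv_shift_funpow)
qed simp

section \<open>Uniqueness and existence of the bracket\<close>

text \<open>Decay carries equality from coordinate \<open>K\<close> to all its positive multiples,
  and every coordinate is determined by a later multiple.\<close>

lemma eq_of_decay:
  assumes x: "x \<in> L" and y: "y \<in> L" and eq: "x K = y K"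
    and decay: "\<And>n. d (x (n + K)) (y (n + K)) \<le> \<gamma> ^ K * d (x n) (y n)"
  shows "x = y"
proof
  have mult: "x (Suc j * K) = y (Suc j * K)" for j
  proof (induction j)
    case (Suc j)
    have "d (x (Suc j * K)) (y (Suc j * K)) = 0"
      using Suc y limit_mem by simp
    then have "d (x (Suc j * K + K)) (y (Suc j * K + K)) \<le> 0"
      using decay[of "Suc j * K"] by simp
    then have "x (Suc j * K + K) = y (Suc j * K + K)"
      using x y limit_mem by (metis nonneg order_antisym zero)
    then show ?case by (simp add: add.commute)
  qed (simp add: eq)
  fix n
  have "n \<le> Suc n * K"
    using K_pos by (simp add: trans_le_add2)
  then show "x n = y n"
    using limit_funpow'[OF x] limit_funpow'[OF y] mult by metis
qed

text \<open>
  Axiom 2 yields no preimages of a point itself, only of its image under \<open>g ^^ K\<close>; hence the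
  chain of points \<open>a j\<close> is not an orbit, but the points \<open>(g ^^ K) (a j)\<close> are.
\<close>

lemma limit_shadowing:
  assumes x: "x \<in> L" and y: "y \<in> L" and "0 < \<rho>" "\<rho> \<le> \<beta>"
    and close: "d (x (2 * K)) (y (2 * K)) \<le> \<rho>"
    and unif: "\<And>u v i. \<lbrakk>u \<in> Y; v \<in> Y; d u v \<le> \<rho>; i \<le> 2 * K\<rbrakk> \<Longrightarrow> d ((g ^^ i) u) ((g ^^ i) v) \<le> \<eta>"
  shows "\<exists>z\<in>L. z K = x K \<and> (\<forall>n. d (z n) (y n) \<le> \<eta>)"
proof -
  \<comment> \<open>The offset 2 fits the start \<open>a = x (2 * K)\<close>, whose image under
    \<open>g ^^ K\<close> is the prescribed coordinate \<open>x K\<close>.\<close>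
  define P where "P j a \<longleftrightarrow> a \<in> Y \<and> d (y ((j + 2) * K)) a \<le> \<rho> \<and> (j = 0 \<longrightarrow> a = x (2 * K))" for j a
  have "\<exists>a. \<forall>j. P j (a j) \<and> (g ^^ (2 * K)) (a (Suc j)) = (g ^^ K) (a j)"
  proof (rule dependent_nat_choice)
    show "\<exists>a. P 0 a"
      using x close limit_mem by (auto simp: P_def commute mult_2)
    fix a j assume P: "P j a"
    \<comment> \<open>Axiom 2 is used at this coordinate of \<open>y\<close>, whose image under
      \<open>g ^^ K\<close> is the centre of the ball containing \<open>a\<close>.\<close>
    have "(g ^^ K) (y ((Suc j + 2) * K)) = y ((j + 2) * K)"
      using limit_funpow[OF y, of K "(j + 2) * K"] by (simp add: algebra_simps)
    then have "(g ^^ K) a \<in> (g ^^ K) ` mcball ((g ^^ K) (y ((Suc j + 2) * K))) \<rho>"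
      using P y limit_mem by (intro imageI) (simp add: P_def)
    then have "(g ^^ K) a \<in> (g ^^ (2 * K)) ` mcball (y ((Suc j + 2) * K)) (\<gamma> * \<rho>)"
      using ax2 assms(3,4) y limit_mem unfolding axiom2_def by blast
    then obtain b where b: "b \<in> mcball (y ((Suc j + 2) * K)) (\<gamma> * \<rho>)" "(g ^^ (2 * K)) b = (g ^^ K) a"
      by (metis imageE)
    moreover have "\<gamma> * \<rho> \<le> \<rho>"
      using \<gamma>_less_1 \<open>0 < \<rho>\<close> by simp
    ultimately show "\<exists>b. P (Suc j) b \<and> (g ^^ (2 * K)) b = (g ^^ K) a"
      unfolding P_def by (intro exI[of _ b]) auto
  qed
  then obtain a where P: "\<And>j. P j (a j)" and a: "\<And>j. (g ^^ (2 * K)) (a (Suc j)) = (g ^^ K) (a j)"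
    by blast
  define b where "b j = (g ^^ K) (a j)" for j
  have b_step: "(g ^^ K) (b (Suc j)) = b j" for j
    using a[of j] by (simp add: b_def mult_2 funpow_add)
  have b_chain: "(g ^^ (i * K)) (b (m + i)) = b m" for i m
  proof (induction i)
    case (Suc i)
    have "(g ^^ (Suc i * K)) (b (m + Suc i)) = (g ^^ (i * K)) ((g ^^ K) (b (Suc (m + i))))"
      by (simp add: funpow_add add.commute[of K])
    then show ?case using Suc b_step by simp
  qed simp
  \<comment> \<open>The point \<open>b j\<close> is to be coordinate \<open>Suc j * K\<close>.
    Coordinate \<open>n\<close> is read off from \<open>b n\<close>, which lies far enough out as
    \<open>n \<le> Suc n * K\<close>.\<close>
  define z where "z n = (g ^^ (Suc n * K - n)) (b n)" for n
  have le: "n \<le> Suc n * K" for n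
    using K_pos by (simp add: trans_le_add2)
  have z: "z \<in> L"
    proof (rule limitI)
    fix n
    show "z n \<in> Y"
      using P by (simp add: z_def b_def P_def funpow_mem)
    have "Suc (Suc (Suc n) * K - Suc n) = (Suc n * K - n) + K"
      using le[of n] le[of "Suc n"] by simp
    then have "g (z (Suc n)) = (g ^^ (Suc n * K - n)) ((g ^^ K) (b (Suc n)))"
      unfolding z_def by (metis comp_apply funpow.simps(2) funpow_add)
    then show "g (z (Suc n)) = z n"
      by (simp add: b_step z_def)
  qed
  have z_b: "z (Suc m * K) = b m" for m
  proof -
    define N where "N = Suc m * K"
    \<comment> \<open>By definition \<open>z N\<close> comes from \<open>b N\<close>, and
      \<open>b_chain\<close> brings this back to \<open>b m\<close> in \<open>N - m\<close> blocks
      of length \<open>K\<close>.\<close>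
    have "N = m + (N - m)" "Suc N * K - N = (N - m) * K"
      using le[of m] by (auto simp: N_def algebra_simps)
    then have "z N = (g ^^ ((N - m) * K)) (b (m + (N - m)))"
      by (simp add: z_def)
    then show ?thesis using b_chain by (simp add: N_def)
  qed
  have "z K = x K"
    using z_b[of 0] P[of 0] limit_funpow[OF x, of K K] by (simp add: b_def P_def mult_2)
  moreover have "d (z n) (y n) \<le> \<eta>" for n
  proof -
    define m where "m = n div K"
    have m: "m * K \<le> n" "n \<le> Suc m * K" "n \<le> (m + 2) * K"
      using K_pos dividend_less_div_times[of K n] by (auto simp: m_def)
    \<comment> \<open>Counting down from coordinate \<open>(m + 2) * K\<close> takes at least
      \<open>K\<close> and at most \<open>2 * K\<close> steps: enough to express \<open>z n\<close>
      through \<open>a m\<close> itself, and within the range of \<open>unif\<close>.\<close>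
    define i where "i = (m + 2) * K - n"
    have i: "i \<le> 2 * K" "i = (Suc m * K - n) + K"
      using m by (auto simp: i_def algebra_simps)
    have "z n = (g ^^ (Suc m * K - n)) (b m)"
      using limit_funpow'[OF z m(2)] z_b by simp
    then have "z n = (g ^^ i) (a m)"
      by (simp add: i(2) b_def funpow_add)
    moreover have "y n = (g ^^ i) (y ((m + 2) * K))"
      using limit_funpow'[OF y m(3)] by (simp add: i_def)
    ultimately show ?thesis
      using unif[of "a m" "y ((m + 2) * K)" i] P[of m] i(1) y limit_mem by (simp add: P_def commute)
  qed
  ultimately show ?thesis using z by blast
qed

text \<open>Half of the bound in \<open>stable_coordinate_eq\<close>, because two points of a local
  set are compared through its centre.\<close>

definition rad :: real where "rad = \<beta> * \<gamma> ^ (2 * K) / 2"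

lemma rad_pos: "rad > 0"
  using \<beta>_pos \<gamma>_pos by (simp add: rad_def)

lemma local_stable_coordinate_eq:
  assumes "x \<in> L" and "y \<in> local_stable L D F x rad" and "z \<in> local_stable L D F x rad"
  shows "y K = z K"
proof (rule stable_coordinate_eq)
  show yz: "y \<in> L" "z \<in> L"
    using assms by (auto simp: local_stable_def)
  fix n
  have "D ((F ^^ n) y) ((F ^^ n) z) \<le> D ((F ^^ n) x) ((F ^^ n) y) + D ((F ^^ n) x) ((F ^^ n) z)"
    using assms yz by (intro hat.triangle'' shift_funpow_mem)
  also have "\<dots> \<le> rad + rad"
    using assms by (intro add_mono) (auto simp: local_stable_def)
  finally show "D ((F ^^ n) y) ((F ^^ n) z) \<le> \<beta> * \<gamma> ^ (2 * K)"
    by (simp add: rad_def)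
qed

lemma local_unstable_decay:
  assumes "x \<in> L" and "y \<in> local_unstable L D F x rad" and "z \<in> local_unstable L D F x rad"
  shows "d (y (n + K)) (z (n + K)) \<le> \<gamma> ^ K * d (y n) (z n)"
proof (rule unstable_coordinate_decay)
  show yz: "y \<in> L" "z \<in> L"
    using assms by (auto simp: local_unstable_def)
  fix n
  have "D ((B ^^ n) y) ((B ^^ n) z) \<le> D ((B ^^ n) x) ((B ^^ n) y) + D ((B ^^ n) x) ((B ^^ n) z)"
    using assms yz by (intro hat.triangle'') (simp_all add: inv_shift_funpow tail_mem)
  also have "\<dots> \<le> rad + rad"
    using assms by (intro add_mono) (auto simp: local_unstable_def)
  also have "\<dots> \<le> \<beta>"
    using \<beta>_pos \<gamma>_pos \<gamma>_less_1 by (simp add: rad_def power_le_one)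
  finally show "D ((B ^^ n) y) ((B ^^ n) z) \<le> \<beta>" .
qed

text \<open>Shadowing gives a point that shares coordinate \<open>K\<close> with \<open>x\<close>,
  hence is stably close to \<open>x\<close>, and stays near \<open>y\<close> in all coordinates,
  hence is unstably close to \<open>y\<close>. Two such points agree at \<open>K\<close> and decay
  towards each other, so \<open>eq_of_decay\<close> identifies them.\<close>

lemma local_bracket:
  "\<exists>\<epsilon>>0. \<forall>x\<in>L. \<forall>y\<in>L. D x y \<le> \<epsilon> \<longrightarrow>
     (\<exists>z. local_stable L D F x rad \<inter> local_unstable L D F y rad = {z})"
proof -
  define \<eta> where "\<eta> = rad / (2 * weight)"
  have \<eta>: "\<eta> > 0" "weight * \<eta> = rad / 2"
    using weight_pos rad_pos by (auto simp: \<eta>_def)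
  obtain \<delta> where \<delta>: "\<delta> > 0"
      "\<forall>u\<in>Y. \<forall>v\<in>Y. d u v < \<delta> \<longrightarrow> (\<forall>i\<le>2 * K. d ((g ^^ i) u) ((g ^^ i) v) < \<eta>)"
    using funpow_uniformly_continuous[OF compact cont \<eta>(1)] by blast
  \<comment> \<open>At most \<beta> for Axiom 2, and strictly below \<delta> because closeness is
    measured with a weak inequality.\<close>
  define \<rho> where "\<rho> = min \<beta> (\<delta> / 2)"
  have \<rho>: "0 < \<rho>" "\<rho> \<le> \<beta>" "\<rho> < \<delta>"
    using \<delta>(1) \<beta>_pos by (auto simp: \<rho>_def)
  \<comment> \<open>The first bound leaves \<open>rad / 2\<close> for the distance from
    \<open>z\<close> to \<open>y\<close> in the triangle inequality; the second cancels the factor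
    of coordinate \<open>2 * K\<close>.\<close>
  define \<epsilon> where "\<epsilon> = min (rad / 2) (\<gamma> ^ (2 * K) * \<rho>)"
  have "\<epsilon> > 0"
    using rad_pos \<rho> \<gamma>_pos by (simp add: \<epsilon>_def)
  moreover have "\<exists>z. local_stable L D F x rad \<inter> local_unstable L D F y rad = {z}"
    if x: "x \<in> L" and y: "y \<in> L" and xy: "D x y \<le> \<epsilon>" for x y
  proof -
    have "\<gamma> ^ (2 * K) * d (x (2 * K)) (y (2 * K)) \<le> \<gamma> ^ (2 * K) * \<rho>"
      using coordinate_le_hat_dist[OF x y, of "2 * K"] xy by (simp add: \<epsilon>_def)
    then have close: "d (x (2 * K)) (y (2 * K)) \<le> \<rho>"
      using \<gamma>_pos by simp
    obtain z where z: "z \<in> L" "z K = x K" "\<And>n. d (z n) (y n) \<le> \<eta>"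
      using limit_shadowing[OF x y \<rho>(1,2) close, where \<eta> = \<eta>] \<delta>(2) \<rho>(3) by (meson less_imp_le order_le_less_trans)
    have zy: "D (tail n z) (tail n y) \<le> rad / 2" for n
      using hat_dist_le_of_all[OF tail_mem tail_mem, OF z(1) y, where \<eta> = \<eta>] z(3) \<eta>(2) by simp
    have "D ((F ^^ n) x) ((F ^^ n) z) \<le> rad" for n
    proof -
      have "D ((F ^^ n) x) ((F ^^ n) z) \<le> \<gamma> ^ n * D x z"
        using hat_dist_shift_funpow_le[OF x z(1)] z(2) by simp
      also have "\<dots> \<le> 1 * D x z"
        using \<gamma>_pos \<gamma>_less_1 by (intro mult_right_mono) (auto simp: power_le_one)
      also have "\<dots> \<le> D x y + D z y"
        using hat.triangle'[OF x y z(1)] by simp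
      also have "\<dots> \<le> rad"
        using zy[of 0] xy by (simp add: \<epsilon>_def)
      finally show ?thesis .
    qed
    then have "z \<in> local_stable L D F x rad"
      using z(1) by (simp add: local_stable_def)
    moreover have "z \<in> local_unstable L D F y rad"
    proof -
      have "D (tail n y) (tail n z) \<le> rad" for n
        using zy[of n] rad_pos hat.commute[of "tail n y" "tail n z"] by simp
      then show ?thesis
        using z(1) y by (simp add: local_unstable_def inv_shift_funpow)
    qed
    moreover have "w = z"
      if "w \<in> local_stable L D F x rad \<inter> local_unstable L D F y rad" for w
    proof (rule eq_of_decay)
      show "w \<in> L" "z \<in> L" using that z(1) by (auto simp: local_stable_def)
      show "w K = z K"
        using local_stable_coordinate_eq[OF x] that \<open>z \<in> local_stable L D F x rad\<close> by blast
      show "d (w (n + K)) (z (n + K)) \<le> \<gamma> ^ K * d (w n) (z n)" for n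
        using local_unstable_decay[OF y] that \<open>z \<in> local_unstable L D F y rad\<close> by blast
    qed
    ultimately show ?thesis by blast
  qed
  ultimately show ?thesis by blast
qed

section \<open>Total disconnectedness of local stable sets\<close>

text \<open>Coordinates at multiples of \<open>K\<close> are shown to be constant on
  \<open>C\<close>, one after another. If one is constant, Axiom 1 makes the next agree for points
  whose coordinates one block further out are within \<beta>. It is thus locally constant in terms
  of that outer coordinate, whose image of \<open>C\<close> is connected.\<close>

lemma local_stable_totally_disconnected:
  assumes x: "x \<in> L" and "r \<le> rad"
  shows "totally_disconnected_in hat.mtopology (local_stable L D F x r)"
  unfolding totally_disconnected_in_def
proof (intro conjI allI impI)
  show "local_stable L D F x r \<subseteq> topspace hat.mtopology"
    by (auto simp: local_stable_def)
  fix C assume C: "C \<subseteq> local_stable L D F x r \<and> connectedin hat.mtopology C"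
  have sub: "C \<subseteq> local_stable L D F x rad"
    using C \<open>r \<le> rad\<close> order_trans unfolding local_stable_def by blast
  then have "C \<subseteq> L" by (auto simp: local_stable_def)
  have const: "u (Suc j * K) = v (Suc j * K)" if "u \<in> C" "v \<in> C" for u v j
    using that
  proof (induction j arbitrary: u v)
    case 0
    then show ?case using local_stable_coordinate_eq[OF x] sub by auto
  next
    case (Suc j)
    let ?p = "Suc j * K + 2 * K" and ?q = "Suc (Suc j) * K"
    let ?S = "(\<lambda>w. w ?p) ` C"
    have S: "connectedin mtopology ?S"
      using connectedin_continuous_map_image[OF continuous_map_coordinate] C by blast
    have q: "(g ^^ K) (w ?p) = w ?q" if "w \<in> C" for w
    proof -
      have "?p = ?q + K" by simp
      then show ?thesis
        using limit_funpow[of w K ?q] that \<open>C \<subseteq> L\<close> by (simp only: subset_iff)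
    qed
    have near: "w ?q = w' ?q" if w: "w \<in> C" "w' \<in> C" and "d (w ?p) (w' ?p) \<le> \<beta>" for w w'
    proof -
      have L: "w \<in> L" "w' \<in> L" using w \<open>C \<subseteq> L\<close> by auto
      have "d (w (Suc j * K + K)) (w' (Suc j * K + K)) \<le> \<gamma> ^ K * d (w (Suc j * K)) (w' (Suc j * K))"
        using axiom1_coordinates[OF L] that(3) by blast
      also have "\<dots> = 0"
        using Suc.IH[OF w] L limit_mem by simp
      finally have "w (Suc j * K + K) = w' (Suc j * K + K)"
        using L limit_mem by (metis nonneg order_antisym zero)
      then show ?thesis by (simp add: add.commute)
    qed
    \<comment> \<open>The radius \<open>\<beta> / 2\<close> makes the two sets disjoint: a common
      point would put two centres within \<beta>, contrary to \<open>near\<close>.\<close>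
    define E where "E = (\<Union>w\<in>{w \<in> C. w ?q = u ?q}. mball (w ?p) (\<beta> / 2))"
    define E' where "E' = (\<Union>w\<in>{w \<in> C. w ?q \<noteq> u ?q}. mball (w ?p) (\<beta> / 2))"
    have "openin mtopology E" "openin mtopology E'"
      unfolding E_def E'_def by auto
    moreover have centre: "w ?p \<in> mball (w ?p) (\<beta> / 2)" if "w \<in> C" for w
      using that \<beta>_pos \<open>C \<subseteq> L\<close> limit_mem by auto
    moreover have "E \<inter> E' \<inter> ?S = {}"
    proof -
      have False if t: "t \<in> E" "t \<in> E'" for t
      proof -
        obtain w w' where w: "w \<in> C" "w ?q = u ?q" "t \<in> mball (w ?p) (\<beta> / 2)"
          and w': "w' \<in> C" "w' ?q \<noteq> u ?q" "t \<in> mball (w' ?p) (\<beta> / 2)"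
          using t unfolding E_def E'_def by blast
        have "d (w ?p) (w' ?p) \<le> \<beta>"
          using w(3) w'(3) triangle'[of "w ?p" t "w' ?p"] by simp
        then show False using near[OF w(1) w'(1)] w(2) w'(2) by simp
      qed
      then show ?thesis by blast
    qed
    moreover have "?S \<subseteq> E \<union> E'"
      using centre unfolding E_def E'_def by blast
    ultimately have "E \<inter> ?S = {} \<or> E' \<inter> ?S = {}"
      using S unfolding connectedin by blast
    moreover have "u ?p \<in> E \<inter> ?S"
      using Suc.prems(1) centre unfolding E_def by blast
    moreover have "v ?p \<in> E' \<inter> ?S" if "v ?q \<noteq> u ?q"
      using that Suc.prems(2) centre unfolding E'_def by blast
    ultimately show ?case by (metis empty_iff)
  qed
  have "u = v" if "u \<in> C" "v \<in> C" for u v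
  proof
    fix n
    have "n \<le> Suc n * K"
      using K_pos by (simp add: trans_le_add2)
    then show "u n = v n"
      using limit_funpow'[of u n] limit_funpow'[of v n] const[OF that] that \<open>C \<subseteq> L\<close> by (metis subsetD)
  qed
  then show "\<exists>a. C \<subseteq> {a}" by blast
qed

lemma limit_smale_space_td_stable: "smale_space_td_stable L D F"
proof -
  obtain \<epsilon>0 where \<epsilon>0: "\<epsilon>0 > 0" "\<And>x y. \<lbrakk>x \<in> L; y \<in> L; D x y \<le> \<epsilon>0\<rbrakk> \<Longrightarrow>
     \<exists>z. local_stable L D F x rad \<inter> local_unstable L D F y rad = {z}"
    using local_bracket by blast
  \<comment> \<open>The cap \<open>rad\<close> is the range of radii for which total
    disconnectedness has been shown.\<close>
  define \<epsilon> where "\<epsilon> = min \<epsilon>0 rad"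
  have "smale_constants L D F \<epsilon> rad \<gamma>"
    unfolding smale_constants_def
  proof (intro conjI ballI allI impI)
    show "\<epsilon> > 0" "rad > 0" "0 < \<gamma>" "\<gamma> < 1"
      using \<epsilon>0 rad_pos \<gamma>_pos \<gamma>_less_1 by (auto simp: \<epsilon>_def)
  next
    fix x n y z assume "x \<in> L" "y \<in> local_stable L D F x rad" "z \<in> local_stable L D F x rad"
    then show "D ((F ^^ n) y) ((F ^^ n) z) \<le> \<gamma> ^ n * D y z"
      by (intro hat_dist_shift_funpow_le local_stable_coordinate_eq) (auto simp: local_stable_def)
  next
    fix x n y z assume "x \<in> L" "y \<in> local_unstable L D F x rad" "z \<in> local_unstable L D F x rad"
    then show "D ((B ^^ n) y) ((B ^^ n) z) \<le> \<gamma> ^ n * D y z"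
      by (intro hat_dist_inv_shift_funpow_le local_unstable_decay) (auto simp: local_unstable_def)
  next
    fix x y assume "x \<in> L" "y \<in> L" "D x y \<le> \<epsilon>"
    then show "\<exists>z. local_stable L D F x rad \<inter> local_unstable L D F y rad = {z}"
      using \<epsilon>0(2) by (simp add: \<epsilon>_def)
  qed
  moreover have "\<forall>x\<in>L. \<forall>r. 0 < r \<and> r \<le> \<epsilon> \<longrightarrow>
      totally_disconnected_in hat.mtopology (local_stable L D F x r)"
    using local_stable_totally_disconnected by (simp add: \<epsilon>_def)
  ultimately show ?thesis
    unfolding smale_space_td_stable_def using limit_compact_metric_homeo by blast
qed

section \<open>Irreducibility\<close>

text \<open>Coordinate 0 is a continuous map onto \<open>Y\<close> that intertwines \<open>F\<close>
  with \<open>g\<close>, so a return of the preimage of \<open>U\<close> projects to a return of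
  \<open>U\<close>.\<close>

lemma non_wandering_base_of_limit:
  assumes "non_wandering hat.mtopology F"
  shows "non_wandering mtopology g"
  unfolding non_wandering_def
proof (intro allI impI)
  fix U assume U: "openin mtopology U \<and> U \<noteq> {}"
  let ?W = "{x \<in> topspace hat.mtopology. x 0 \<in> U}"
  have "openin hat.mtopology ?W"
    by (rule openin_continuous_map_preimage[OF continuous_map_coordinate conjunct1[OF U]])
  moreover obtain x where "x \<in> L" "x 0 \<in> U"
  proof -
    obtain y where "y \<in> U" "y \<in> Y"
      using U openin_subset[OF conjunct1[OF U]] by auto
    then show ?thesis using that limit_through[of y 0] by metis
  qed
  then have "?W \<noteq> {}" by auto
  ultimately obtain n where n: "n \<ge> 1" "(F ^^ n) ` ?W \<inter> ?W \<noteq> {}"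
    using assms unfolding non_wandering_def by blast
  then obtain w where "w 0 \<in> U" "(F ^^ n) w 0 \<in> U"
    by auto
  then show "\<exists>n\<ge>1. (g ^^ n) ` U \<inter> U \<noteq> {}"
    using n(1) by (auto simp: shift_funpow)
qed

text \<open>An open set in the limit contains the preimage of an open \<open>U\<close> under one
  coordinate, and a returning point of \<open>U\<close> lifts through that coordinate.\<close>

lemma non_wandering_limit_of_base:
  assumes "non_wandering mtopology g"
  shows "non_wandering hat.mtopology F"
  unfolding non_wandering_def
proof (intro allI impI)
  fix W assume W: "openin hat.mtopology W \<and> W \<noteq> {}"
  then obtain x where "x \<in> W" by blast
  then obtain n U where U: "openin mtopology U" "x n \<in> U" "\<And>y. y \<in> L \<Longrightarrow> y n \<in> U \<Longrightarrow> y \<in> W"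
    using W limit_open_contains_coordinate_open by metis
  then obtain k u where k: "k \<ge> 1" "u \<in> U" "(g ^^ k) u \<in> U"
    using assms unfolding non_wandering_def by blast
  then obtain y where y: "y \<in> L" "y n = u"
    using limit_through[of u n] openin_subset[OF U(1)] by auto
  then have "y \<in> W" "(F ^^ k) y \<in> W"
    using U(3) k shift_funpow_mem by (auto simp: shift_funpow)
  then show "\<exists>n\<ge>1. (F ^^ n) ` W \<inter> W \<noteq> {}"
    using k(1) by blast
qed

text \<open>The dense orbit in the limit is two-sided, so transitivity is projected to
  \<open>Y\<close> in place of the orbit; Baire's theorem in \<open>Y\<close> then produces a
  forward orbit.\<close>

lemma dense_forward_orbit_base_of_limit:
  assumes nw: "non_wandering hat.mtopology F" and orbit: "has_dense_orbit hat.mtopology F"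
  shows "has_dense_forward_orbit mtopology g"
proof (rule transitive_imp_dense_forward_orbit[OF compact cont])
  show "Y \<noteq> {}"
    using orbit limit_mem unfolding has_dense_orbit_def by auto
  fix U V assume UV: "openin mtopology U" "U \<noteq> {}" "openin mtopology V" "V \<noteq> {}"
  have lift: "openin hat.mtopology {x \<in> topspace hat.mtopology. x 0 \<in> T} \<and>
      {x \<in> topspace hat.mtopology. x 0 \<in> T} \<noteq> {}" if T: "openin mtopology T" "T \<noteq> {}" for T
  proof
    show "openin hat.mtopology {x \<in> topspace hat.mtopology. x 0 \<in> T}"
      by (rule openin_continuous_map_preimage[OF continuous_map_coordinate T(1)])
    obtain x where "x \<in> L" "x 0 \<in> T"
    proof -
      obtain y where "y \<in> T" "y \<in> Y"
        using T openin_subset[OF T(1)] by auto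
      then show ?thesis using that limit_through[of y 0] by metis
    qed
    then show "{x \<in> topspace hat.mtopology. x 0 \<in> T} \<noteq> {}" by auto
  qed
  obtain n x where "x 0 \<in> U" "(F ^^ n) x 0 \<in> V"
    using dense_orbit_transitive[OF nw shift_homeomorphic orbit
        conjunct1[OF lift[OF UV(1,2)]] conjunct2[OF lift[OF UV(1,2)]]
        conjunct1[OF lift[OF UV(3,4)]] conjunct2[OF lift[OF UV(3,4)]]] by auto
  then show "\<exists>n. \<exists>x\<in>U. (g ^^ n) x \<in> V"
    by (auto simp: shift_funpow)
qed

lemma dense_orbit_limit_of_base:
  assumes "has_dense_forward_orbit mtopology g"
  shows "has_dense_orbit hat.mtopology F"
proof -
  obtain y where y: "y \<in> Y" "mtopology closure_of (range (\<lambda>n. (g ^^ n) y)) = topspace mtopology"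
    using assms unfolding has_dense_forward_orbit_def by auto
  obtain x where x: "x \<in> L" "x 0 = y"
    using limit_through[OF y(1)] by blast
  have dense: "\<exists>n. int_iterate (topspace hat.mtopology) F n x \<in> W"
    if W: "openin hat.mtopology W" "W \<noteq> {}" for W
  proof -
    obtain w where "w \<in> W" using W by blast
    then obtain n U where U: "openin mtopology U" "w n \<in> U" "\<And>y. y \<in> L \<Longrightarrow> y n \<in> U \<Longrightarrow> y \<in> W"
      using W limit_open_contains_coordinate_open by metis
    have "U \<noteq> {}" using U(2) by blast
    then obtain k where "(g ^^ k) y \<in> U"
      using dense_range_meets_open[OF y(2) U(1)] by blast
    \<comment> \<open>The extra \<open>n\<close> shifts bring \<open>x 0 = y\<close> to coordinate
      \<open>n\<close>, so already the forward half of the orbit of \<open>x\<close> is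
      dense.\<close>
    moreover have "(F ^^ (k + n)) x n = (g ^^ k) y"
      using limit_funpow[OF x(1), of n 0] x(2) by (simp add: shift_funpow funpow_add)
    ultimately have "(F ^^ (k + n)) x \<in> W"
      using U(3) shift_funpow_mem[OF x(1)] by simp
    moreover have "(F ^^ (k + n)) x = int_iterate (topspace hat.mtopology) F (int (k + n)) x"
      by (simp add: int_iterate_def nat_int_add)
    ultimately show ?thesis by metis
  qed
  show ?thesis
    unfolding has_dense_orbit_def
    using x(1) dense_rangeI[of hat.mtopology "\<lambda>n. int_iterate (topspace hat.mtopology) F n x"] dense
    by (intro bexI[of _ x]) simp_all
qed

lemma limit_irreducible_iff:
  "irreducible_smale_space L D F \<longleftrightarrow>
     non_wandering mtopology g \<and> has_dense_forward_orbit mtopology g"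
proof -
  have "smale_space L D F"
    using limit_smale_space_td_stable unfolding smale_space_td_stable_def smale_space_def by blast
  then show ?thesis
    unfolding irreducible_smale_space_def
    using non_wandering_base_of_limit non_wandering_limit_of_base
      dense_forward_orbit_base_of_limit dense_orbit_limit_of_base by blast
qed

end

theorem theoremA:
  fixes Y :: "'a set" and d :: "'a \<Rightarrow> 'a \<Rightarrow> real" and g :: "'a \<Rightarrow> 'a"
    and \<beta> \<gamma> :: real and K :: nat
  assumes "Metric_space Y d"
    and "compact_space (Metric_space.mtopology Y d)"
    and "continuous_map (Metric_space.mtopology Y d) (Metric_space.mtopology Y d) g"
    and "g ` Y = Y"
    and "\<beta> > 0" and "K \<ge> 1" and "0 < \<gamma>" and "\<gamma> < 1"
    and "axiom1 Y d g \<beta> K \<gamma>"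
    and "axiom2 Y d g \<beta> K \<gamma>"
  shows "smale_space_td_stable (inv_limit Y g) (hat_dist Y d g K \<gamma>) (shift_map g) \<and>
    (irreducible_smale_space (inv_limit Y g) (hat_dist Y d g K \<gamma>) (shift_map g) \<longleftrightarrow>
       non_wandering (Metric_space.mtopology Y d) g \<and>
       has_dense_forward_orbit (Metric_space.mtopology Y d) g)"
proof -
  interpret wieler_system Y d g \<beta> \<gamma> K
    using assms by (simp add: wieler_system_def wieler_system_axioms_def)
  show ?thesis
    using limit_smale_space_td_stable limit_irreducible_iff by blast
qed

end
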